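(* Let $M$ and $N$ be manifolds-with-boundary equipped with free circle actions on neighbourhoods of their boundaries. Let $M_{\mathrm{cut}}$ and $N_{\mathrm{cut}}$ be the corresponding cut spaces with quotient maps $c_M \colon M\to M_{\mathrm{cut}}$ and $c_N \colon N\to N_{\mathrm{cut}}$. Let $\psi \colon M\to N$ be an equivariant transverse map. Then there exists a unique map $\psi_{\mathrm{cut}} \colon M_{\mathrm{cut}}\to N_{\mathrm{cut}}$ such that $\psi_{\mathrm{cut}}\circ c_M = c_N\circ\psi$. Moreover: (1) $\psi_{\mathrm{cut}}$ takes $\mathring{M}_{\mathrm{cut}}$ to $\mathring{N}_{\mathrm{cut}}$ and $M_{\mathrm{red}}$ to $N_{\mathrm{red}}$. (2) If $\psi$ is one-to-one, so is $\psi_{\mathrm{cut}}$. If $\psi$ is onto, so is $\psi_{\mathrm{cut}}$. (3) $\psi_{\mathrm{cut}}$ is continuous. (4) If $\psi$ is open, so is $\psi_{\mathrm{cut}}$. (5) If $\psi$ is open as a map to its image, so is $\psi_{\mathrm{cut}}$.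
   Context: Manifolds, with or without boundary, are smooth, Hausdorff and second countable. For a manifold-with-boundary $M$, $\mathring{M}$ denotes the interior and $\partial M$ the boundary. "A free circle action on a neighbourhood of the boundary" means a smooth free action of $S^1$ on an open neighbourhood $U_M$ of $\partial M$ in $M$; necessarily $\partial M$ is $S^1$-invariant. Cut space: let $\sim$ be the equivalence relation on $M$ in which distinct points are equivalent iff they both lie in $\partial M$ and lie in the same $S^1$-orbit. $M_{\mathrm{cut}} := M/{\sim}$ with the quotient topology; $c_M \colon M \to M_{\mathrm{cut}}$ is the quotient map. $\mathring{M}_{\mathrm{cut}} := c_M(\mathring{M})$ and $M_{\mathrm{red}} := c_M(\partial M)=(\partial M)/S^1$. An invariant boundary defining function on $M$ is a smooth $f \colon M \to \mathbb{R}_{\ge 0}$ such that $f^{-1}(0)=\partial M$, $df|_{\partial M}$ never vanishes, and $f$ is $S^1$-invariant on some $S^1$-invariant neighbourhood of $\partial M$ in $U_M$. A map $\psi \colon M\to N$ is an equivariant transverse map if: $\psi$ is smooth; for some (hence every) invariant boundary defining function $f_N$ on $N$, the composition $f_N\circ\psi$ is an invariant boundary defining function on $M$ (hence $\psi(\mathring{M})\subset\mathring{N}$ and $\psi(\partial M)\subset\partial N$); and there is an $S^1$-invariant neighbourhood $V$ of $\partial M$ in $M$, contained in $U_M\cap\psi^{-1}(U_N)$, such that $\psi|_V \colon V\to U_N$ is $S^1$-equivariant. *)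

theory Defs
  imports "HOL-Analysis.Analysis"
begin

section \<open>Smooth maps between subsets of normed spaces\<close>

primrec Ck_on :: "nat \<Rightarrow> 'a::real_normed_vector set \<Rightarrow> ('a \<Rightarrow> 'b::real_normed_vector) \<Rightarrow> bool" where
  "Ck_on 0 W f \<longleftrightarrow> continuous_on W f"
| "Ck_on (Suc k) W f \<longleftrightarrow>
     (\<forall>x\<in>W. f differentiable (at x)) \<and>
     (\<forall>v. Ck_on k W (\<lambda>x. frechet_derivative f (at x) v))"

text \<open>
  Smoothness on an arbitrary subset \<open>S\<close> means local extendability to smooth functions on
  open sets of the ambient space. For relatively open subsets of a (half-)space this is the usual
  notion of smoothness up to the boundary; on \<open>S\<^sup>1 \<times> D\<close>, with the circle embedded in
  the complex plane, it is smoothness on the product manifold.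
\<close>

definition smooth_on_subset ::
    "'a::real_normed_vector set \<Rightarrow> ('a \<Rightarrow> 'b::real_normed_vector) \<Rightarrow> bool" where
  "smooth_on_subset S f \<longleftrightarrow>
     (\<forall>x\<in>S. \<exists>W g. open W \<and> x \<in> W \<and> (\<forall>k. Ck_on k W g) \<and> (\<forall>y\<in>S \<inter> W. g y = f y))"

section \<open>Smooth manifolds with boundary\<close>

text \<open>
  The points are the elements of \<open>topspace (topo M)\<close>. The local model is a linear subspace
  \<open>model M\<close> of a Euclidean space, playing the role of \<open>\<real>\<^sup>n\<close> with
  \<open>n = dim (model M)\<close>; a subspace rather than the whole space is used so that \<open>n = 0\<close> is
  included. A chart is a pair of a domain and a coordinate map; the values of the latter outside
  the domain are irrelevant.
\<close>

record ('a, 'e) charted_space =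
  topo :: "'a topology"
  model :: "'e set"
  atlas :: "('a set \<times> ('a \<Rightarrow> 'e)) set"

abbreviation points :: "('a, 'e) charted_space \<Rightarrow> 'a set" where
  "points M \<equiv> topspace (topo M)"

definition is_chart :: "('a, 'e::euclidean_space) charted_space \<Rightarrow> 'a set \<Rightarrow> ('a \<Rightarrow> 'e) \<Rightarrow> bool" where
  "is_chart M A \<phi> \<longleftrightarrow>
     openin (topo M) A \<and>
     homeomorphic_map (subtopology (topo M) A) (top_of_set (\<phi> ` A)) \<phi> \<and>
     (openin (top_of_set (model M)) (\<phi> ` A) \<or>
      (\<exists>u \<in> model M - {0}. openin (top_of_set {y \<in> model M. 0 \<le> u \<bullet> y}) (\<phi> ` A)))"

definition smooth_manifold_with_boundary :: "('a, 'e::euclidean_space) charted_space \<Rightarrow> bool" where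
  "smooth_manifold_with_boundary M \<longleftrightarrow>
     Hausdorff_space (topo M) \<and> second_countable (topo M) \<and> subspace (model M) \<and>
     (\<forall>(A, \<phi>) \<in> atlas M. is_chart M A \<phi>) \<and>
     (\<Union>(A, \<phi>) \<in> atlas M. A) = points M \<and>
     (\<forall>(A, \<phi>) \<in> atlas M. \<forall>(B, \<eta>) \<in> atlas M.
        smooth_on_subset (\<phi> ` (A \<inter> B)) (\<lambda>y. \<eta> (inv_into A \<phi> y)))"

text \<open>
  By smooth invariance of the boundary, the complement of the interior consists of the points sent
  to the bounding hyperplane by every (equivalently, some) half-space chart around them.
\<close>

definition mfd_interior :: "('a, 'e::euclidean_space) charted_space \<Rightarrow> 'a set" where
  "mfd_interior M =
     {x \<in> points M. \<exists>(A, \<phi>) \<in> atlas M.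
        x \<in> A \<and> \<phi> x \<in> top_of_set (model M) interior_of (\<phi> ` A)}"

definition mfd_boundary :: "('a, 'e::euclidean_space) charted_space \<Rightarrow> 'a set" where
  "mfd_boundary M = points M - mfd_interior M"

definition smooth_map ::
    "('a, 'e::euclidean_space) charted_space \<Rightarrow> ('b, 'f::euclidean_space) charted_space
       \<Rightarrow> ('a \<Rightarrow> 'b) \<Rightarrow> bool" where
  "smooth_map M N f \<longleftrightarrow>
     continuous_map (topo M) (topo N) f \<and>
     (\<forall>(A, \<phi>) \<in> atlas M. \<forall>(B, \<eta>) \<in> atlas N.
        smooth_on_subset (\<phi> ` {x \<in> A. f x \<in> B}) (\<lambda>y. \<eta> (f (inv_into A \<phi> y))))"

definition real_line :: "(real, real) charted_space" where
  "real_line = \<lparr>topo = euclidean, model = UNIV, atlas = {(UNIV, id)}\<rparr>"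

text \<open>
  At a boundary point a derivative within \<open>\<phi> ` A\<close> is determined only along \<open>model M\<close>, so it is
  tested only there.
\<close>

definition differential_nonzero_at ::
    "('a, 'e::euclidean_space) charted_space \<Rightarrow> ('a \<Rightarrow> real) \<Rightarrow> 'a \<Rightarrow> bool" where
  "differential_nonzero_at M f x \<longleftrightarrow>
     (\<forall>(A, \<phi>) \<in> atlas M. x \<in> A \<longrightarrow>
        (\<exists>D. ((\<lambda>y. f (inv_into A \<phi> y)) has_derivative D) (at (\<phi> x) within \<phi> ` A) \<and>
             (\<exists>v \<in> model M. D v \<noteq> 0)))"

section \<open>Circle actions near the boundary\<close>

abbreviation circle :: "complex set" where
  "circle \<equiv> sphere 0 1"

definition circle_invariant :: "(complex \<Rightarrow> 'a \<Rightarrow> 'a) \<Rightarrow> 'a set \<Rightarrow> bool" where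
  "circle_invariant act V \<longleftrightarrow> (\<forall>z\<in>circle. \<forall>x\<in>V. act z x \<in> V)"

text \<open>The values of \<open>act z x\<close> for \<open>z \<notin> circle\<close> or \<open>x \<notin> U\<close> are irrelevant.\<close>

definition smooth_circle_action ::
    "('a, 'e::euclidean_space) charted_space \<Rightarrow> 'a set \<Rightarrow> (complex \<Rightarrow> 'a \<Rightarrow> 'a) \<Rightarrow> bool" where
  "smooth_circle_action M U act \<longleftrightarrow>
     circle_invariant act U \<and>
     (\<forall>x\<in>U. act 1 x = x) \<and>
     (\<forall>z\<in>circle. \<forall>w\<in>circle. \<forall>x\<in>U. act (z * w) x = act z (act w x)) \<and>
     continuous_map (prod_topology (top_of_set circle) (subtopology (topo M) U))
       (subtopology (topo M) U) (\<lambda>(z, x). act z x) \<and>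
     (\<forall>(A, \<phi>) \<in> atlas M. \<forall>(B, \<eta>) \<in> atlas M.
        smooth_on_subset
          {(z, y). z \<in> circle \<and> y \<in> \<phi> ` (A \<inter> U) \<and> act z (inv_into A \<phi> y) \<in> B}
          (\<lambda>(z, y). \<eta> (act z (inv_into A \<phi> y))))"

definition free_circle_action_near_boundary ::
    "('a, 'e::euclidean_space) charted_space \<Rightarrow> 'a set \<Rightarrow> (complex \<Rightarrow> 'a \<Rightarrow> 'a) \<Rightarrow> bool" where
  "free_circle_action_near_boundary M U act \<longleftrightarrow>
     openin (topo M) U \<and> mfd_boundary M \<subseteq> U \<and>
     smooth_circle_action M U act \<and>
     (\<forall>z\<in>circle. \<forall>x\<in>U. act z x = x \<longrightarrow> z = 1)"

definition invariant_nhd_of_boundary ::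
    "('a, 'e::euclidean_space) charted_space \<Rightarrow> (complex \<Rightarrow> 'a \<Rightarrow> 'a) \<Rightarrow> 'a set \<Rightarrow> bool" where
  "invariant_nhd_of_boundary M act V \<longleftrightarrow>
     V \<subseteq> points M \<and> mfd_boundary M \<subseteq> topo M interior_of V \<and> circle_invariant act V"

definition invariant_boundary_defining ::
    "('a, 'e::euclidean_space) charted_space \<Rightarrow> 'a set \<Rightarrow> (complex \<Rightarrow> 'a \<Rightarrow> 'a)
       \<Rightarrow> ('a \<Rightarrow> real) \<Rightarrow> bool" where
  "invariant_boundary_defining M U act f \<longleftrightarrow>
     smooth_map M real_line f \<and> (\<forall>x \<in> points M. 0 \<le> f x) \<and>
     {x \<in> points M. f x = 0} = mfd_boundary M \<and>
     (\<forall>x \<in> mfd_boundary M. differential_nonzero_at M f x) \<and>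
     (\<exists>V \<subseteq> U. invariant_nhd_of_boundary M act V \<and>
        (\<forall>z\<in>circle. \<forall>x\<in>V. f (act z x) = f x))"

definition equivariant_transverse_map ::
    "('a, 'e::euclidean_space) charted_space \<Rightarrow> 'a set \<Rightarrow> (complex \<Rightarrow> 'a \<Rightarrow> 'a)
       \<Rightarrow> ('b, 'f::euclidean_space) charted_space \<Rightarrow> 'b set \<Rightarrow> (complex \<Rightarrow> 'b \<Rightarrow> 'b)
       \<Rightarrow> ('a \<Rightarrow> 'b) \<Rightarrow> bool" where
  "equivariant_transverse_map M U act N U' act' \<psi> \<longleftrightarrow>
     smooth_map M N \<psi> \<and>
     (\<exists>f. invariant_boundary_defining N U' act' f \<and>
          invariant_boundary_defining M U act (f \<circ> \<psi>)) \<and>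
     (\<exists>V \<subseteq> U \<inter> {x \<in> points M. \<psi> x \<in> U'}. invariant_nhd_of_boundary M act V \<and>
        (\<forall>z\<in>circle. \<forall>x\<in>V. \<psi> (act z x) = act' z (\<psi> x)))"

section \<open>Cut spaces\<close>

definition quotient_topology :: "'a topology \<Rightarrow> ('a \<times> 'a) set \<Rightarrow> 'a set topology" where
  "quotient_topology X R =
     topology (\<lambda>\<U>. \<U> \<subseteq> topspace X // R \<and> openin X {x \<in> topspace X. R `` {x} \<in> \<U>})"

lemma openin_quotient_topology:
  "openin (quotient_topology X R) \<U> \<longleftrightarrow>
     \<U> \<subseteq> topspace X // R \<and> openin X {x \<in> topspace X. R `` {x} \<in> \<U>}"
proof -
  let ?P = "\<lambda>\<U>. \<U> \<subseteq> topspace X // R \<and> openin X {x \<in> topspace X. R `` {x} \<in> \<U>}"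
  have "?P (S \<inter> T)" if "?P S" "?P T" for S T
  proof -
    have "{x \<in> topspace X. R `` {x} \<in> S \<inter> T} =
        {x \<in> topspace X. R `` {x} \<in> S} \<inter> {x \<in> topspace X. R `` {x} \<in> T}"
      by blast
    then show ?thesis using that by auto
  qed
  moreover have "?P (\<Union>\<K>)" if "\<forall>K\<in>\<K>. ?P K" for \<K>
  proof -
    have "{x \<in> topspace X. R `` {x} \<in> \<Union>\<K>} = (\<Union>K\<in>\<K>. {x \<in> topspace X. R `` {x} \<in> K})"
      by blast
    then show ?thesis using that by auto
  qed
  ultimately have "istopology ?P"
    unfolding istopology_def by blast
  then show ?thesis
    by (simp add: quotient_topology_def topology_inverse')
qed

lemma topspace_quotient_topology: "topspace (quotient_topology X R) = topspace X // R"
proof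
  show "topspace (quotient_topology X R) \<subseteq> topspace X // R"
    using openin_quotient_topology[of X R "topspace (quotient_topology X R)"] by simp
  have "{x \<in> topspace X. R `` {x} \<in> topspace X // R} = topspace X"
    by (auto simp: quotient_def)
  then have "openin (quotient_topology X R) (topspace X // R)"
    by (simp add: openin_quotient_topology)
  then show "topspace X // R \<subseteq> topspace (quotient_topology X R)"
    by (rule openin_subset)
qed

lemma quotient_map_quotient_topology:
  "quotient_map X (quotient_topology X R) (\<lambda>x. R `` {x})"
  unfolding quotient_map_def topspace_quotient_topology openin_quotient_topology
  by (auto simp: quotient_def)

definition cut_rel ::
    "('a, 'e::euclidean_space) charted_space \<Rightarrow> (complex \<Rightarrow> 'a \<Rightarrow> 'a) \<Rightarrow> ('a \<times> 'a) set" where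
  "cut_rel M act =
     {(x, y). x \<in> points M \<and> y \<in> points M \<and>
        (x = y \<or> x \<in> mfd_boundary M \<and> y \<in> mfd_boundary M \<and> (\<exists>z\<in>circle. y = act z x))}"

definition cut_space ::
    "('a, 'e::euclidean_space) charted_space \<Rightarrow> (complex \<Rightarrow> 'a \<Rightarrow> 'a) \<Rightarrow> 'a set topology" where
  "cut_space M act = quotient_topology (topo M) (cut_rel M act)"

definition cut_map ::
    "('a, 'e::euclidean_space) charted_space \<Rightarrow> (complex \<Rightarrow> 'a \<Rightarrow> 'a) \<Rightarrow> 'a \<Rightarrow> 'a set" where
  "cut_map M act x = cut_rel M act `` {x}"

definition cut_interior ::
    "('a, 'e::euclidean_space) charted_space \<Rightarrow> (complex \<Rightarrow> 'a \<Rightarrow> 'a) \<Rightarrow> 'a set set" where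
  "cut_interior M act = cut_map M act ` mfd_interior M"

definition reduced_space ::
    "('a, 'e::euclidean_space) charted_space \<Rightarrow> (complex \<Rightarrow> 'a \<Rightarrow> 'a) \<Rightarrow> 'a set set" where
  "reduced_space M act = cut_map M act ` mfd_boundary M"

lemma equiv_cut_rel:
  assumes "free_circle_action_near_boundary M U act"
  shows "equiv (points M) (cut_rel M act)"
proof (rule equivI)
  have bU: "mfd_boundary M \<subseteq> U" and one: "\<And>x. x \<in> U \<Longrightarrow> act 1 x = x"
    and mult: "\<And>z w x. norm z = 1 \<Longrightarrow> norm w = 1 \<Longrightarrow> x \<in> U \<Longrightarrow>
                 act (z * w) x = act z (act w x)"
    using assms
    by (auto simp: free_circle_action_near_boundary_def smooth_circle_action_def)
  show "cut_rel M act \<subseteq> points M \<times> points M"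
    by (auto simp: cut_rel_def)
  show "refl_on (points M) (cut_rel M act)"
    by (auto simp: refl_on_def cut_rel_def)
  show "sym (cut_rel M act)"
  proof (rule symI)
    fix x y assume xy: "(x, y) \<in> cut_rel M act"
    show "(y, x) \<in> cut_rel M act"
    proof (cases "x = y")
      case False
      then obtain z where z: "norm z = 1" "y = act z x"
        and b: "x \<in> mfd_boundary M" "y \<in> mfd_boundary M"
        using xy by (auto simp: cut_rel_def)
      have "x = act (inverse z * z) x"
        using z(1) b(1) bU one by (metis left_inverse norm_zero subsetD zero_neq_one)
      also have "\<dots> = act (inverse z) y"
        using mult[of "inverse z" z x] z b bU by (auto simp: norm_inverse)
      finally have "\<exists>w\<in>circle. x = act w y"
        using z(1) by (intro bexI[of _ "inverse z"]) (auto simp: norm_inverse)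
      then show ?thesis
        using xy b by (auto simp: cut_rel_def)
    qed (use xy in simp)
  qed
  show "trans (cut_rel M act)"
  proof (rule transI)
    fix x y w assume xy: "(x, y) \<in> cut_rel M act" and yw: "(y, w) \<in> cut_rel M act"
    show "(x, w) \<in> cut_rel M act"
    proof (cases "x = y \<or> y = w")
      case False
      then obtain a b where "norm a = 1" "y = act a x" "norm b = 1" "w = act b y"
        and b: "x \<in> mfd_boundary M" "w \<in> mfd_boundary M"
        using xy yw by (auto simp: cut_rel_def)
      then have "w = act (b * a) x" "norm (b * a) = 1"
        using mult[of b a x] bU by (auto simp: norm_mult)
      then have "\<exists>c\<in>circle. w = act c x"
        by (intro bexI[of _ "b * a"]) auto
      then show ?thesis
        using xy yw b by (auto simp: cut_rel_def)
    qed (use xy yw in auto)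
  qed
qed

end

theory Submission
  imports Defs
begin

text \<open>
  The zero set of the boundary defining function is \<open>\<partial>N\<close>, and that of its pullback is \<open>\<partial>M\<close>.
  So \<open>\<psi>\<close> preserves and reflects the boundary, and invariance of the defining function makes the
  boundary closed and circle-invariant. By equivariance \<open>\<psi>\<close> maps each cut class of \<open>M\<close> onto
  a cut class of \<open>N\<close>. Hence images of saturated sets are saturated, which gives openness of
  \<open>\<psi>cut\<close>. For openness onto the image one also needs to shrink an open set of \<open>N\<close> to a
  saturated one; this works because the circle is compact, so that \<open>c\<^sub>N\<close> is a closed map.
\<close>

section \<open>Maps induced between quotient spaces\<close>

lemma open_map_quotient_lift:
  assumes q: "quotient_map X Y q" and p: "quotient_map X' Y' p"
    and f: "f ` topspace X \<subseteq> topspace X'"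
    and g: "\<And>x. x \<in> topspace X \<Longrightarrow> g (q x) = p (f x)"
    and fibre: "\<And>x y. x \<in> topspace X \<Longrightarrow> y \<in> topspace X' \<Longrightarrow> p y = p (f x) \<Longrightarrow>
                  \<exists>x'\<in>topspace X. q x' = q x \<and> f x' = y"
    and "open_map X X' f"
  shows "open_map Y Y' g"
  unfolding open_map_def
proof (intro allI impI)
  fix W assume W: "openin Y W"
  define A where "A = {x \<in> topspace X. q x \<in> W}"
  have "openin X A"
    unfolding A_def using W q by (metis openin_subset quotient_map_def)
  then have "openin X' (f ` A)"
    using \<open>open_map X X' f\<close> by (simp add: open_map_def)
  have WA: "W = q ` A"
    using quotient_imp_surjective_map[OF q] openin_subset[OF W] by (auto simp: A_def)
  have "g ` W = (\<lambda>x. p (f x)) ` A"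
    unfolding WA image_image by (rule image_cong) (auto simp: A_def g)
  have "y \<in> f ` A" if y: "y \<in> topspace X'" "p y = p (f x)" and x: "x \<in> A" for x y
  proof -
    obtain x' where "x' \<in> topspace X" "q x' = q x" "f x' = y"
      using fibre[of x y] x y by (auto simp: A_def)
    then show ?thesis
      using x by (auto simp: A_def)
  qed
  then have "{y \<in> topspace X'. p y \<in> g ` W} = f ` A"
    using \<open>g ` W = _\<close> f by (auto simp: A_def)
  moreover have "g ` W \<subseteq> topspace Y'"
    using \<open>g ` W = _\<close> quotient_imp_surjective_map[OF p] f A_def by blast
  ultimately show "openin Y' (g ` W)"
    using p \<open>openin X' (f ` A)\<close> unfolding quotient_map_def by metis
qed

text \<open>Here \<open>f\<close>
  A\<open>is only the trace on the image of an open set\<close>G\<open>, and\<close>G\<open>need not be saturated for\<close>p\<open>. Closedness of\<close>p\<open>makes the set of fibres lying wholly inside\<close>G\<open>open in\<close>Y'\<open>, and this set cuts out\<close>g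
  \<open>W\<close>.\<close>

lemma open_map_image_quotient_lift:
  assumes q: "quotient_map X Y q" and p: "quotient_map X' Y' p" and "closed_map X' Y' p"
    and f: "f ` topspace X \<subseteq> topspace X'"
    and g: "\<And>x. x \<in> topspace X \<Longrightarrow> g (q x) = p (f x)"
    and fibre: "\<And>x y. x \<in> topspace X \<Longrightarrow> y \<in> topspace X' \<Longrightarrow> p y = p (f x) \<Longrightarrow>
                  \<exists>x'\<in>topspace X. q x' = q x \<and> f x' = y"
    and "open_map X (subtopology X' (f ` topspace X)) f"
  shows "open_map Y (subtopology Y' (g ` topspace Y)) g"
  unfolding open_map_def
proof (intro allI impI)
  fix W assume W: "openin Y W"
  define A where "A = {x \<in> topspace X. q x \<in> W}"
  have "openin X A"
    unfolding A_def using W q by (metis openin_subset quotient_map_def)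
  then obtain G where G: "openin X' G" "f ` A = G \<inter> f ` topspace X"
    using assms(7) by (force simp: open_map_def openin_subtopology)
  have WA: "W = q ` A"
    using quotient_imp_surjective_map[OF q] openin_subset[OF W] by (auto simp: A_def)
  have gW: "g ` W = (\<lambda>x. p (f x)) ` A"
    unfolding WA image_image by (rule image_cong) (auto simp: A_def g)
  have gY: "g ` topspace Y = (\<lambda>x. p (f x)) ` topspace X"
    unfolding quotient_imp_surjective_map[OF q, symmetric] image_image
    by (rule image_cong) (auto simp: g)
  \<comment> \<open>the image of the largest saturated subset of \<open>G\<close>\<close>
  define H where "H = topspace Y' - p ` (topspace X' - G)"
  have "openin Y' H"
    unfolding H_def using \<open>closed_map X' Y' p\<close> G(1)
    by (intro openin_diff openin_topspace) (auto simp: closed_map_def)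
  moreover have "g ` W = H \<inter> g ` topspace Y"
  proof
    have "p (f x) \<in> H" if x: "x \<in> A" for x
    proof -
      have "p (f x) \<in> topspace Y'"
        using x f quotient_imp_surjective_map[OF p] by (auto simp: A_def)
      \<comment> \<open>By \<open>fibre\<close>, the whole fibre of \<open>p\<close> through
        \<open>f x\<close> is hit from the fibre of \<open>q\<close> through \<open>x\<close>. That
        fibre lies in the saturated set \<open>A\<close>, so no point of the fibre of
        \<open>p\<close> can leave \<open>G\<close>.\<close>
      moreover have False if y: "y \<in> topspace X' - G" "p y = p (f x)" for y
      proof -
        obtain x' where "x' \<in> topspace X" "q x' = q x" "f x' = y"
          using fibre[of x y] x y by (auto simp: A_def)
        then have "y \<in> f ` A"
          using x by (auto simp: A_def)
        then show False
          using G y by auto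
      qed
      ultimately show ?thesis
        by (force simp: H_def)
    qed
    then show "g ` W \<subseteq> H \<inter> g ` topspace Y"
      using gW gY by (auto simp: A_def)
    show "H \<inter> g ` topspace Y \<subseteq> g ` W"
    proof
      fix y assume y: "y \<in> H \<inter> g ` topspace Y"
      then obtain x where x: "x \<in> topspace X" "y = p (f x)"
        using gY by auto
      then have "f x \<in> G"
        using y f by (auto simp: H_def)
      \<comment> \<open>The point \<open>x\<close> itself need not be shown to lie in
        \<open>A\<close>: some point of \<open>A\<close> with the same value under \<open>f\<close>
        suffices.\<close>
      then have "f x \<in> f ` A"
        using G x by auto
      then show "y \<in> g ` W"
        using gW x by auto
    qed
  qed
  ultimately show "openin (subtopology Y' (g ` topspace Y)) (g ` W)"
    by (auto simp: openin_subtopology)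
qed

section \<open>The cut map\<close>

lemma quotient_map_cut_map: "quotient_map (topo M) (cut_space M act) (cut_map M act)"
  using quotient_map_quotient_topology[of "topo M" "cut_rel M act"]
  by (simp add: cut_space_def cut_map_def[abs_def])

lemma cut_map_eq_iff:
  assumes "free_circle_action_near_boundary M U act" "x \<in> points M" "y \<in> points M"
  shows "cut_map M act x = cut_map M act y \<longleftrightarrow>
    x = y \<or> x \<in> mfd_boundary M \<and> y \<in> mfd_boundary M \<and> (\<exists>z\<in>circle. y = act z x)"
  using eq_equiv_class_iff[OF equiv_cut_rel[OF assms(1)] assms(2,3)] assms(2,3)
  by (simp add: cut_map_def cut_rel_def)

text \<open>The saturation of a closed set \<open>C\<close> adds the boundary points whose orbits
  meet \<open>C\<close>. These form the projection of a closed subset of circle times boundary along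
  the compact circle, so they are closed in the boundary, which is closed in
  \<open>M\<close>.\<close>

lemma closed_map_cut_map:
  fixes M :: "('a, 'e::euclidean_space) charted_space"
  assumes act: "free_circle_action_near_boundary M U act"
    and closed: "closedin (topo M) (mfd_boundary M)"
    and inv: "circle_invariant act (mfd_boundary M)"
  shows "closed_map (topo M) (cut_space M act) (cut_map M act)"
  unfolding closed_map_def
proof (intro allI impI)
  fix C assume C: "closedin (topo M) C"
  let ?B = "mfd_boundary M" and ?S = "top_of_set circle"
  let ?X = "subtopology (topo M) ?B"
  have BU: "?B \<subseteq> U" and BM: "?B \<subseteq> points M"
    and cont: "continuous_map (prod_topology ?S (subtopology (topo M) U))
      (subtopology (topo M) U) (\<lambda>(z, x). act z x)"
    using act by (auto simp: free_circle_action_near_boundary_def smooth_circle_action_def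
        mfd_boundary_def)
  have "continuous_map (prod_topology ?S ?X) (topo M) (\<lambda>(z, x). act z x)"
  proof -
    \<comment> \<open>Continuity of the action is given on the circle times \<open>U\<close>; seeing
      circle times boundary as a subspace of it allows restriction.\<close>
    have "prod_topology ?S ?X =
        subtopology (prod_topology ?S (subtopology (topo M) U)) (UNIV \<times> ?B)"
      using BU by (simp add: prod_topology_subtopology subtopology_subtopology)
        (rule arg_cong[where f = "subtopology _"], auto)
    then show ?thesis
      using continuous_map_from_subtopology[OF continuous_map_into_fulltopology[OF cont]] by simp
  qed
  then have "closedin (prod_topology ?S ?X)
      {w \<in> topspace (prod_topology ?S ?X). (\<lambda>(z, x). act z x) w \<in> C}" (is "closedin _ ?D")
    using C by (rule closedin_continuous_map_preimage)
  \<comment> \<open>Compactness of the circle enters here.\<close>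
  moreover have "closed_map (prod_topology ?S ?X) ?X snd"
    by (rule closed_map_snd) (simp add: compact_space_subtopology)
  ultimately have "closedin ?X (snd ` ?D)"
    unfolding closed_map_def by blast
  moreover have "?D = {(z, y). z \<in> circle \<and> y \<in> ?B \<and> act z y \<in> C}"
    using BM by auto
  moreover have "snd ` {(z, y). z \<in> circle \<and> y \<in> ?B \<and> act z y \<in> C} =
      {y \<in> ?B. \<exists>z\<in>circle. act z y \<in> C}"
    by auto (metis (mono_tags, lifting) case_prodI image_eqI mem_Collect_eq snd_conv)
  ultimately have "closedin ?X {y \<in> ?B. \<exists>z\<in>circle. act z y \<in> C}"
    by (simp only:)
  then have "closedin (topo M) {y \<in> ?B. \<exists>z\<in>circle. act z y \<in> C}"
    using closed by (rule closedin_trans_full)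
  moreover have "{y \<in> points M. cut_map M act y \<in> cut_map M act ` C} =
      C \<union> {y \<in> ?B. \<exists>z\<in>circle. act z y \<in> C}"
  proof -
    have CM: "C \<subseteq> points M"
      using C by (rule closedin_subset)
    have "cut_map M act y \<in> cut_map M act ` C \<longleftrightarrow>
        y \<in> C \<or> y \<in> ?B \<and> (\<exists>z\<in>circle. act z y \<in> C)" if y: "y \<in> points M" for y
    proof -
      have "cut_map M act y \<in> cut_map M act ` C \<longleftrightarrow>
          (\<exists>x\<in>C. y = x \<or> y \<in> ?B \<and> x \<in> ?B \<and> (\<exists>z\<in>circle. x = act z y))"
        using CM y by (auto simp: image_iff cut_map_eq_iff[OF act y] subset_iff)
      then show ?thesis
        \<comment> \<open>Invariance puts \<open>act z y\<close> in the boundary, as the cut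
          relation demands of both points.\<close>
        using inv unfolding circle_invariant_def by blast
    qed
    then show ?thesis
      using CM BM by blast
  qed
  ultimately have "closedin (topo M) {y \<in> points M. cut_map M act y \<in> cut_map M act ` C}"
    using C by (simp only: closedin_Un)
  moreover have "cut_map M act ` C \<subseteq> topspace (cut_space M act)"
    using quotient_imp_surjective_map[OF quotient_map_cut_map[of M act]] closedin_subset[OF C]
    by blast
  then have "closedin (topo M) {y \<in> points M. cut_map M act y \<in> cut_map M act ` C} =
      closedin (cut_space M act) (cut_map M act ` C)"
    by (rule quotient_map_cut_map[unfolded quotient_map_closedin, THEN conjunct2, rule_format])
  ultimately show "closedin (cut_space M act) (cut_map M act ` C)"
    by (simp only:)
qed

text \<open>The boundary is the zero set of the continuous \<open>f\<close> within
  \<open>points M\<close>. Along an orbit starting in it \<open>f\<close> stays zero, and the orbit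
  stays in \<open>V\<close>, hence in \<open>points M\<close>.\<close>

lemma boundary_if_invariant_boundary_defining:
  assumes "invariant_boundary_defining M U act f"
  shows closedin_mfd_boundary: "closedin (topo M) (mfd_boundary M)"
    and circle_invariant_mfd_boundary: "circle_invariant act (mfd_boundary M)"
proof -
  have B: "mfd_boundary M = {x \<in> points M. f x \<in> {0}}"
    and "continuous_map (topo M) euclidean f"
    using assms by (auto simp: invariant_boundary_defining_def smooth_map_def real_line_def)
  then show "closedin (topo M) (mfd_boundary M)"
    using closedin_continuous_map_preimage[of "topo M" euclidean f "{0}"] by simp
  obtain V where V: "invariant_nhd_of_boundary M act V"
      "\<And>z x. z \<in> circle \<Longrightarrow> x \<in> V \<Longrightarrow> f (act z x) = f x"
    using assms by (auto simp: invariant_boundary_defining_def)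
  then have "V \<subseteq> points M" "circle_invariant act V" "mfd_boundary M \<subseteq> V"
    using interior_of_subset[of "topo M" V] by (auto simp: invariant_nhd_of_boundary_def)
  then show "circle_invariant act (mfd_boundary M)"
    using V(2) by (auto simp: circle_invariant_def B subset_iff)
qed

theorem lemma2p2:
  fixes M :: "('a, 'e::euclidean_space) charted_space"
    and N :: "('b, 'f::euclidean_space) charted_space"
    and U\<^sub>M :: "'a set" and act\<^sub>M :: "complex \<Rightarrow> 'a \<Rightarrow> 'a"
    and U\<^sub>N :: "'b set" and act\<^sub>N :: "complex \<Rightarrow> 'b \<Rightarrow> 'b"
    and \<psi> :: "'a \<Rightarrow> 'b"
  assumes "smooth_manifold_with_boundary M"
    and "smooth_manifold_with_boundary N"
    and "free_circle_action_near_boundary M U\<^sub>M act\<^sub>M"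
    and "free_circle_action_near_boundary N U\<^sub>N act\<^sub>N"
    and "equivariant_transverse_map M U\<^sub>M act\<^sub>M N U\<^sub>N act\<^sub>N \<psi>"
  shows "\<exists>\<psi>cut. 
    (\<psi>cut \<in> topspace (cut_space M act\<^sub>M) \<rightarrow>\<^sub>E topspace (cut_space N act\<^sub>N) \<and>
     (\<forall>x \<in> points M. \<psi>cut (cut_map M act\<^sub>M x) = cut_map N act\<^sub>N (\<psi> x))) \<and>
    (\<forall>\<psi>'. \<psi>' \<in> topspace (cut_space M act\<^sub>M) \<rightarrow>\<^sub>E topspace (cut_space N act\<^sub>N) \<and>
          (\<forall>x \<in> points M. \<psi>' (cut_map M act\<^sub>M x) = cut_map N act\<^sub>N (\<psi> x))
          \<longrightarrow> \<psi>' = \<psi>cut) \<and>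
    (\<psi>cut ` cut_interior M act\<^sub>M \<subseteq> cut_interior N act\<^sub>N \<and>
     \<psi>cut ` reduced_space M act\<^sub>M \<subseteq> reduced_space N act\<^sub>N) \<and>
    ((inj_on \<psi> (points M) \<longrightarrow> inj_on \<psi>cut (topspace (cut_space M act\<^sub>M))) \<and>
     (\<psi> ` points M = points N \<longrightarrow>
        \<psi>cut ` topspace (cut_space M act\<^sub>M) = topspace (cut_space N act\<^sub>N))) \<and>
    continuous_map (cut_space M act\<^sub>M) (cut_space N act\<^sub>N) \<psi>cut \<and>
    (open_map (topo M) (topo N) \<psi> \<longrightarrow>
       open_map (cut_space M act\<^sub>M) (cut_space N act\<^sub>N) \<psi>cut) \<and>
    (open_map (topo M) (subtopology (topo N) (\<psi> ` points M)) \<psi> \<longrightarrow>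
       open_map (cut_space M act\<^sub>M)
         (subtopology (cut_space N act\<^sub>N) (\<psi>cut ` topspace (cut_space M act\<^sub>M))) \<psi>cut)"
proof -
  let ?B = "mfd_boundary M" and ?B' = "mfd_boundary N"
  let ?q = "cut_map M act\<^sub>M" and ?p = "cut_map N act\<^sub>N"
  let ?Y = "cut_space M act\<^sub>M" and ?Y' = "cut_space N act\<^sub>N"
  note q = quotient_map_cut_map[of M act\<^sub>M] and p = quotient_map_cut_map[of N act\<^sub>N]
  note q_eq = cut_map_eq_iff[OF assms(3)] and p_eq = cut_map_eq_iff[OF assms(4)]
  note q_surj = quotient_imp_surjective_map[OF q] and p_surj = quotient_imp_surjective_map[OF p]

  \<comment> \<open>Behaviour of \<psi> on the boundary and on orbits\<close>
  obtain f V where cont: "continuous_map (topo M) (topo N) \<psi>"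
    and f: "invariant_boundary_defining N U\<^sub>N act\<^sub>N f"
      "invariant_boundary_defining M U\<^sub>M act\<^sub>M (f \<circ> \<psi>)"
    and V: "invariant_nhd_of_boundary M act\<^sub>M V"
      "\<forall>z\<in>circle. \<forall>x\<in>V. \<psi> (act\<^sub>M z x) = act\<^sub>N z (\<psi> x)"
    using assms(5) unfolding equivariant_transverse_map_def smooth_map_def by blast
  have \<psi>: "\<psi> ` points M \<subseteq> points N"
    using cont by (rule continuous_map_image_subset_topspace)
  have B_iff: "\<psi> x \<in> ?B' \<longleftrightarrow> x \<in> ?B" if "x \<in> points M" for x
  proof -
    have "{x \<in> points N. f x = 0} = ?B'" "{x \<in> points M. (f \<circ> \<psi>) x = 0} = ?B"
      using f by (simp_all only: invariant_boundary_defining_def)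
    then show ?thesis
      using that \<psi> by auto
  qed
  have BM: "?B \<subseteq> points M"
    by (auto simp: mfd_boundary_def)
  have inv: "act\<^sub>M z x \<in> ?B" if "z \<in> circle" "x \<in> ?B" for z x
    using circle_invariant_mfd_boundary[OF f(2)] that by (simp add: circle_invariant_def)
  have equivar: "\<psi> (act\<^sub>M z x) = act\<^sub>N z (\<psi> x)" if "z \<in> circle" "x \<in> ?B" for z x
    using V that interior_of_subset[of "topo M" V]
    by (auto simp: invariant_nhd_of_boundary_def)
  have p_const: "?p (\<psi> x) = ?p (\<psi> y)"
    if xy: "x \<in> points M" "y \<in> points M" "?q x = ?q y" for x y
  proof (cases "x = y")
    case False
    then obtain z where "x \<in> ?B" "y \<in> ?B" "z \<in> circle" "y = act\<^sub>M z x"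
      using xy q_eq by blast
    then have "\<psi> x \<in> ?B'" "\<psi> y \<in> ?B'" "\<psi> y = act\<^sub>N z (\<psi> x)"
      using B_iff[OF xy(1)] B_iff[OF xy(2)] equivar by auto
    then show ?thesis
      using p_eq[of "\<psi> x" "\<psi> y"] xy \<psi> \<open>z \<in> circle\<close> by blast
  qed simp
  have fibre: "\<exists>x'\<in>points M. ?q x' = ?q x \<and> \<psi> x' = y"
    if xy: "x \<in> points M" "y \<in> points N" "?p y = ?p (\<psi> x)" for x y
  proof (cases "y = \<psi> x")
    case False
    have "\<psi> x \<in> points N"
      using xy \<psi> by auto
    then obtain z where z: "\<psi> x \<in> ?B'" "z \<in> circle" "y = act\<^sub>N z (\<psi> x)"
      using False xy p_eq[of "\<psi> x" y] by auto
    \<comment> \<open>Since \<psi> reflects the boundary, the orbit of \<open>x\<close> is collapsed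
      too. The circle element \<open>z\<close> that moves \<open>\<psi> x\<close> to
      \<open>y\<close> then moves \<open>x\<close> within its class to a preimage of
      \<open>y\<close>.\<close>
    then have x: "x \<in> ?B"
      using B_iff xy by blast
    then have x': "act\<^sub>M z x \<in> ?B"
      using inv z by blast
    then have "?q x = ?q (act\<^sub>M z x)"
      using q_eq[of x "act\<^sub>M z x"] BM x z(2) by blast
    then show ?thesis
      using x x' BM equivar z by (intro bexI[of _ "act\<^sub>M z x"]) auto
  qed (use xy in auto)

  \<comment> \<open>Existence and uniqueness of the induced map\<close>
  have "continuous_map (topo M) ?Y' (\<lambda>x. ?p (\<psi> x))"
    using continuous_map_compose[OF cont quotient_imp_continuous_map[OF p]]
    by (simp add: comp_def)
  then obtain h where h: "continuous_map ?Y ?Y' h"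
    "\<And>x. x \<in> points M \<Longrightarrow> h (?q x) = ?p (\<psi> x)"
    using p_const by (rule quotient_map_lift_exists[OF q]) (assumption+, rule that, assumption, simp)
  \<comment> \<open>Fixing the values off the cut space to \<open>undefined\<close> makes uniqueness
    an equality of functions.\<close>
  define g where "g = restrict h (topspace ?Y)"
  have g_cont: "continuous_map ?Y ?Y' g"
    using h(1) by (rule continuous_map_eq) (simp add: g_def)
  have g: "g (?q x) = ?p (\<psi> x)" if "x \<in> points M" for x
    using h(2)[OF that] that q_surj by (auto simp: g_def)
  have g_PiE: "g \<in> topspace ?Y \<rightarrow>\<^sub>E topspace ?Y'"
    using continuous_map_image_subset_topspace[OF g_cont] by (auto simp: g_def)
  have unique: "\<psi>' = g" if \<psi>': "\<psi>' \<in> topspace ?Y \<rightarrow>\<^sub>E topspace ?Y'"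
    "\<forall>x\<in>points M. \<psi>' (?q x) = ?p (\<psi> x)" for \<psi>'
  proof (rule PiE_ext[OF \<psi>'(1) g_PiE])
    fix y assume "y \<in> topspace ?Y"
    then obtain x where "x \<in> points M" "y = ?q x"
      using q_surj by blast
    then show "\<psi>' y = g y"
      using \<psi>'(2) g by simp
  qed

  \<comment> \<open>Properties of the induced map\<close>
  have interior: "g ` cut_interior M act\<^sub>M \<subseteq> cut_interior N act\<^sub>N"
  proof -
    have int: "mfd_interior M = points M - ?B" "mfd_interior N = points N - ?B'"
      by (auto simp: mfd_boundary_def mfd_interior_def)
    show ?thesis
      unfolding cut_interior_def int using \<psi> B_iff g by auto
  qed
  have reduced: "g ` reduced_space M act\<^sub>M \<subseteq> reduced_space N act\<^sub>N"
    unfolding reduced_space_def using BM B_iff g by auto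
  have inj: "inj_on g (topspace ?Y)" if "inj_on \<psi> (points M)"
  proof -
    have eq: "?q x = ?q y" if xy: "x \<in> points M" "y \<in> points M" "?p (\<psi> x) = ?p (\<psi> y)" for x y
    proof -
      \<comment> \<open>Lifting \<open>\<psi> x\<close> into the class of \<open>y\<close> gives
        \<open>x'\<close>; injectivity of \<psi> forces \<open>x' = x\<close>, so \<open>x\<close>
        lies in that class.\<close>
      obtain x' where "x' \<in> points M" "?q x' = ?q y" "\<psi> x' = \<psi> x"
        using fibre[of y "\<psi> x"] xy \<psi> by auto
      then show ?thesis
        using \<open>inj_on \<psi> (points M)\<close> xy by (metis inj_onD)
    qed
    show ?thesis
    proof (rule inj_onI)
      fix a b assume ab: "a \<in> topspace ?Y" "b \<in> topspace ?Y" "g a = g b"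
      obtain x where x: "x \<in> points M" "a = ?q x"
        using ab(1) q_surj by blast
      obtain y where y: "y \<in> points M" "b = ?q y"
        using ab(2) q_surj by blast
      have "?p (\<psi> x) = ?p (\<psi> y)"
        using ab(3) x y g[of x] g[of y] by simp
      then show "a = b"
        using eq[of x y] x y by simp
    qed
  qed
  have surj: "g ` topspace ?Y = topspace ?Y'" if "\<psi> ` points M = points N"
    unfolding q_surj[symmetric] p_surj[symmetric] that[symmetric] image_image
    by (rule image_cong) (auto simp: g)
  have open_g: "open_map ?Y ?Y' g" if "open_map (topo M) (topo N) \<psi>"
    by (rule open_map_quotient_lift[OF q p \<psi> g fibre that])
  \<comment> \<open>The defining function \<open>f\<close> on \<open>N\<close> supplies the closed,
    invariant boundary required here.\<close>
  have "closed_map (topo N) ?Y' ?p"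
    using closed_map_cut_map[OF assms(4)] boundary_if_invariant_boundary_defining[OF f(1)] by blast
  then have open_image_g: "open_map ?Y (subtopology ?Y' (g ` topspace ?Y)) g"
    if "open_map (topo M) (subtopology (topo N) (\<psi> ` points M)) \<psi>"
    by (rule open_map_image_quotient_lift[OF q p _ \<psi> g fibre that])
  show ?thesis
  proof (rule exI[of _ g], intro conjI allI impI ballI)
    show "g (?q x) = ?p (\<psi> x)" if "x \<in> points M" for x
      using that by (rule g)
    show "\<psi>' = g" if "\<psi>' \<in> topspace ?Y \<rightarrow>\<^sub>E topspace ?Y' \<and>
        (\<forall>x\<in>points M. \<psi>' (?q x) = ?p (\<psi> x))" for \<psi>'
      using that unique by blast
  qed (fact g_PiE interior reduced inj surj g_cont open_g open_image_g | assumption)+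
qed

end
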